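(* Let $P=\frac1{2^3}\delta_1+\frac1{2^2}\delta_2+\frac12\delta_3+\sum_{j=4}^\infty\frac1{2^j}\delta_j$. The set $\{Av[1,2],3,Av[4,5],Av[6,\infty)\}$ forms the optimal set of four-means for $P$ with quantization error $V_4(P)=\frac16$.
   Context: $\delta_x$ denotes the Dirac measure at $x\in\mathbb R$. For a Borel probability measure $P$ on $\mathbb R$ and a nonempty finite set $\alpha\subset\mathbb R$, the distortion error is $V(P;\alpha)=\int\min_{a\in\alpha}|x-a|^2\,dP(x)$. The $n$th quantization error is $V_n(P)=\inf\{V(P;\alpha):\alpha\subset\mathbb R,\ 1\le\mathrm{card}(\alpha)\le n\}$. An optimal set of $n$-means for $P$ is a set $\alpha$ with at most $n$ points for which this infimum is attained. With $p_m=P(\{m\})$ and $i\le\ell$ positive integers, $Av[i,\ell]=\frac{\sum_{m=i}^{\ell}p_m m}{\sum_{m=i}^{\ell}p_m}$ and $Av[i,\infty)=\frac{\sum_{m=i}^{\infty}p_m m}{\sum_{m=i}^{\infty}p_m}$. *)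

theory Defs
  imports "HOL-Probability.Probability"
begin

text \<open>Errors are taken in \<^typ>\<open>ennreal\<close>, so that no integrability side condition is needed and the
  infimum is the one of a complete lattice. \<^const>\<open>Min\<close> is only meaningful for finite nonempty sets;
  the definitions below use it for no others.\<close>

definition distortion :: "real measure \<Rightarrow> real set \<Rightarrow> ennreal" where
  "distortion M \<alpha> = (\<integral>\<^sup>+ x. ennreal (Min ((\<lambda>a. \<bar>x - a\<bar>\<^sup>2) ` \<alpha>)) \<partial>M)"

definition quantization_error :: "real measure \<Rightarrow> nat \<Rightarrow> ennreal" where
  "quantization_error M n =
     Inf {distortion M \<alpha> | \<alpha>. finite \<alpha> \<and> 1 \<le> card \<alpha> \<and> card \<alpha> \<le> n}"

definition optimal_set_of_means :: "real measure \<Rightarrow> nat \<Rightarrow> real set \<Rightarrow> bool" where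
  "optimal_set_of_means M n \<alpha> \<longleftrightarrow>
     finite \<alpha> \<and> 1 \<le> card \<alpha> \<and> card \<alpha> \<le> n \<and> distortion M \<alpha> = quantization_error M n"

definition Av :: "real measure \<Rightarrow> nat \<Rightarrow> nat \<Rightarrow> real" where
  "Av M i l = (\<Sum>m=i..l. measure M {real m} * real m) / (\<Sum>m=i..l. measure M {real m})"

definition Av_inf :: "real measure \<Rightarrow> nat \<Rightarrow> real" where
  "Av_inf M i =
     (\<Sum>k. measure M {real (i + k)} * real (i + k)) / (\<Sum>k. measure M {real (i + k)})"

text \<open>The Dirac measure at \<open>x\<close> is \<^term>\<open>return borel x\<close>. The series over \<open>j \<ge> 4\<close> is indexed by
  \<open>j = k + 4\<close>.\<close>

definition P_mix_fun :: "real set \<Rightarrow> ennreal" where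
  "P_mix_fun A =
     ennreal (1 / 2 ^ 3) * emeasure (return borel 1) A
   + ennreal (1 / 2 ^ 2) * emeasure (return borel 2) A
   + ennreal (1 / 2) * emeasure (return borel 3) A
   + (\<Sum>k. ennreal (1 / 2 ^ (k + 4)) * emeasure (return borel (real (k + 4))) A)"

definition P_mix :: "real measure" where
  "P_mix = measure_of UNIV (sets borel) P_mix_fun"

text \<open>Since \<^const>\<open>measure_of\<close> yields the null measure when its argument is not countably additive,
  we check that \<open>P_mix\<close> takes the intended values and is a probability measure.\<close>

lemma space_P_mix [simp]: "space P_mix = UNIV"
  by (simp add: P_mix_def space_measure_of_conv)

lemma sets_P_mix [simp, measurable_cong]: "sets P_mix = sets borel"
  unfolding P_mix_def by (metis sets.sets_measure_of_eq space_borel)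

lemma countably_additive_P_mix_fun: "countably_additive (sets borel) P_mix_fun"
proof (rule countably_additiveI)
  fix A :: "nat \<Rightarrow> real set"
  assume A: "range A \<subseteq> sets borel" and disj: "disjoint_family A"
  have dirac: "(\<Sum>i. emeasure (return borel x) (A i)) = emeasure (return borel x) (\<Union> (range A))"
    for x :: real
    by (rule suminf_emeasure) (use A disj in auto)
  have swap: "(\<Sum>i. \<Sum>k. f k i) = (\<Sum>k. \<Sum>i. f k i)" for f :: "nat \<Rightarrow> nat \<Rightarrow> ennreal"
    using nn_integral_suminf[of f "count_space UNIV"]
    by (simp add: nn_integral_count_space_nat)
  have "(\<Sum>i. \<Sum>k. ennreal (1 / 2 ^ (k + 4)) * emeasure (return borel (real (k + 4))) (A i))
      = (\<Sum>k. \<Sum>i. ennreal (1 / 2 ^ (k + 4)) * emeasure (return borel (real (k + 4))) (A i))"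
    by (rule swap)
  then show "(\<Sum>i. P_mix_fun (A i)) = P_mix_fun (\<Union> (range A))"
    unfolding P_mix_fun_def
    by (simp add: suminf_add[symmetric] dirac del: emeasure_return)
qed

lemma emeasure_P_mix:
  assumes "A \<in> sets borel"
  shows "emeasure P_mix A = P_mix_fun A"
  unfolding P_mix_def
proof (rule emeasure_measure_of_sigma)
  show "sigma_algebra UNIV (sets (borel :: real measure))"
    by (metis sets.sigma_algebra_axioms space_borel)
  show "positive (sets borel) P_mix_fun"
    by (simp add: positive_def P_mix_fun_def)
qed (use assms countably_additive_P_mix_fun in auto)

lemma prob_space_P_mix: "prob_space P_mix"
proof (rule prob_spaceI)
  have "(\<lambda>k. 1 / 2 ^ (k + 4) :: real) sums (1 / 8)"
    using sums_mult[OF power_half_series, of "1/8"] by (simp add: power_add power_divide mult.commute)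
  then have "(\<Sum>k. ennreal (1 / 2 ^ (k + 4))) = ennreal (1 / 8)"
    by (intro suminf_ennreal_eq) auto
  then have "P_mix_fun UNIV = ennreal (1 / 8) + ennreal (1 / 4) + ennreal (1 / 2) + ennreal (1 / 8)"
    unfolding P_mix_fun_def by simp
  also have "\<dots> = ennreal (1 / 8 + 1 / 4 + 1 / 2 + 1 / 8)"
    by (simp only: ennreal_plus divide_nonneg_nonneg add_nonneg_nonneg zero_le_one zero_le_numeral)
  also have "\<dots> = 1"
    by simp
  finally show "emeasure P_mix (space P_mix) = 1"
    by (simp add: emeasure_P_mix)
qed

end

theory Submission
  imports Defs "HOL-Real_Asymp.Real_Asymp"
begin

text \<open>A nearest-point map from the atoms \<open>1, 2, 3, \<dots>\<close> to a competitor \<open>\<alpha>\<close> is monotone and takes at most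
  four values, so it is determined by at most three jumps, after which it is constant. Distinguishing
  where the jumps occur among the atoms \<open>1, \<dots>, 7\<close>, the distortion is bounded below by variances of
  finite blocks plus the variance of a geometric tail. Only the partition into \<open>{1,2}\<close>, \<open>{3}\<close>, \<open>{4,5}\<close>,
  \<open>{6, 7, \<dots>}\<close> has such a bound as low as \<open>1/6\<close>, attained
  only when each block is represented by its mean.\<close>

section \<open>The measure as a weighted series over the naturals\<close>

definition weight :: "nat \<Rightarrow> real" where
  "weight k = (if k = 0 then 0 else if k < 4 then 2 ^ k / 16 else 1 / 2 ^ k)"

lemma weight_nonneg: "0 \<le> weight k"
  by (simp add: weight_def)

lemma weight_numeral:
  "weight 0 = 0" "weight (Suc 0) = 1/8" "weight 1 = 1/8" "weight 2 = 1/4" "weight 3 = 1/2"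
  "weight 4 = 1/16" "weight 5 = 1/32" "weight 6 = 1/64" "weight 7 = 1/128"
  by (simp_all add: weight_def)

text \<open>Viewing the measure as the image of a discrete one on the naturals turns every integral
  against it into a series.\<close>

lemma P_mix_eq_distr:
  "P_mix = distr (density (count_space UNIV) (\<lambda>k. ennreal (weight k))) borel real"
  (is "_ = ?D")
proof (rule measure_eqI)
  show "sets P_mix = sets ?D"
    by simp
  fix A :: "real set"
  assume "A \<in> sets P_mix"
  then have A: "A \<in> sets borel"
    by simp
  let ?g = "\<lambda>k. ennreal (weight k) * indicator A (real k)"
  have "emeasure ?D A = (\<integral>\<^sup>+ k. ennreal (weight k) * indicator (real -` A) k \<partial>count_space UNIV)"
    using A by (subst emeasure_distr) (auto simp: emeasure_density)
  also have "\<dots> = (\<Sum>k. ?g k)"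
    by (simp add: nn_integral_count_space_nat indicator_def)
  also have "\<dots> = (\<Sum>k. ?g (k + 4)) + (\<Sum>k<4. ?g k)"
    by (rule suminf_offset) simp
  \<comment> \<open>The index 0 is not an atom and has weight 0; \<open>2 ^ k / 16\<close> gives
    1/8, 1/4, 1/2 at 1, 2, 3.\<close>
  also have "(\<Sum>k<4. ?g k) = ?g 1 + ?g 2 + ?g 3"
    by (simp add: eval_nat_numeral weight_def)
  also have "(\<Sum>k. ?g (k + 4)) =
      (\<Sum>k. ennreal (1 / 2 ^ (k + 4)) * emeasure (return borel (real (k + 4))) A)"
    using A by (simp add: weight_def)
  finally have "emeasure ?D A = P_mix_fun A"
    using A by (simp add: P_mix_fun_def weight_numeral ac_simps)
  then show "emeasure P_mix A = emeasure ?D A"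
    using A by (simp add: emeasure_P_mix)
qed

lemma nn_integral_P_mix:
  assumes [measurable]: "f \<in> borel_measurable borel"
  shows "(\<integral>\<^sup>+ x. f x \<partial>P_mix) = (\<Sum>k. ennreal (weight k) * f (real k))"
  by (simp add: P_mix_eq_distr nn_integral_distr nn_integral_density nn_integral_count_space_nat)

lemma measure_P_mix_singleton: "measure P_mix {real m} = weight m"
proof -
  have "emeasure P_mix {real m} = (\<Sum>k. ennreal (weight k) * indicator {real m} (real k))"
    by (subst nn_integral_P_mix[symmetric]) (auto simp: nn_integral_indicator)
  also have "\<dots> = (\<Sum>k\<in>{m}. ennreal (weight k) * indicator {real m} (real k))"
    by (rule suminf_finite) auto
  finally show ?thesis
    by (simp add: measure_def weight_nonneg)
qed

section \<open>First and second moments of geometric tails\<close>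

lemma geometric_linear_sums: "(\<lambda>k. (real k + b) / 2 ^ k) sums (2 * (1 + b))"
proof -
  \<comment> \<open>\<open>?g k\<close> is the remainder of the series from index \<open>k\<close>
    on, so the sum telescopes to \<open>?g 0\<close>.\<close>
  let ?g = "\<lambda>k. 2 * (real k + 1 + b) / 2 ^ k"
  have "?g \<longlonglongrightarrow> 0"
    by real_asymp
  moreover have "?g k - ?g (Suc k) = (real k + b) / 2 ^ k" for k
    by (simp add: field_simps)
  ultimately show ?thesis
    using telescope_sums'[of ?g 0] by simp
qed

lemma geometric_square_sums: "(\<lambda>k. (real k + b)\<^sup>2 / 2 ^ k) sums (2 * (2 + (1 + b)\<^sup>2))"
proof -
  let ?g = "\<lambda>k. 2 * (2 + (real k + 1 + b)\<^sup>2) / 2 ^ k"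
  have "?g \<longlonglongrightarrow> 0"
    by real_asymp
  moreover have "?g k - ?g (Suc k) = (real k + b)\<^sup>2 / 2 ^ k" for k
    by (simp add: field_simps power2_eq_square)
  ultimately show ?thesis
    using telescope_sums'[of ?g 0] by (simp add: add.commute)
qed

text \<open>Parallel-axis identity: from 4 on the weights are geometric, so the atoms n, n+1, ...
  have mass 2/2^n, mean n+1 and variance 2.\<close>

lemma tail_sums:
  assumes "4 \<le> n"
  shows "(\<lambda>k. weight (k + n) * (real (k + n) - a)\<^sup>2) sums (2 * (2 + (real n + 1 - a)\<^sup>2) / 2 ^ n)"
proof -
  have "weight (k + n) * (real (k + n) - a)\<^sup>2 = (real k + (real n - a))\<^sup>2 / 2 ^ k / 2 ^ n" for k
    using assms by (simp add: weight_def power_add algebra_simps)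
  then show ?thesis
    using sums_divide[OF geometric_square_sums[of "real n - a"], of "2 ^ n"]
    by (simp add: algebra_simps)
qed

lemma summable_weight_square: "summable (\<lambda>k. weight k * (real k - a)\<^sup>2)"
  using tail_sums[of 4 a] summable_iff_shift[of "\<lambda>k. weight k * (real k - a)\<^sup>2" 4]
  by (auto simp: sums_iff)

section \<open>Monotone nearest-point maps with few values\<close>

text \<open>If b < a, then k would lie at or above the midpoint of a and b and l at or below it,
  against k < l. Ties are covered.\<close>

lemma nearest_point_mono:
  fixes a b k l :: real
  assumes "\<bar>k - a\<bar> \<le> \<bar>k - b\<bar>" "\<bar>l - b\<bar> \<le> \<bar>l - a\<bar>" "k < l"
  shows "a \<le> b"
  using assms by linarith

text \<open>For a monotone map a fourth change of value would produce a fifth distinct point of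
  \<alpha>.\<close>

lemma mono_const_after_three_jumps:
  fixes f :: "nat \<Rightarrow> real"
  assumes "mono f" "range f \<subseteq> \<alpha>" "finite \<alpha>" "card \<alpha> \<le> 4"
    and "i \<le> j" "j \<le> m" "m \<le> n" "f i \<noteq> f j" "f j \<noteq> f m" "f m \<noteq> f n" "n \<le> k"
  shows "f k = f n"
proof (rule ccontr)
  assume "f k \<noteq> f n"
  moreover have "f i \<le> f j" "f j \<le> f m" "f m \<le> f n" "f n \<le> f k"
    using assms by (auto dest: monoD)
  ultimately have "card {f i, f j, f m, f n, f k} = 5"
    using assms by auto
  moreover have "card {f i, f j, f m, f n, f k} \<le> card \<alpha>"
    using assms by (intro card_mono) auto
  ultimately show False
    using assms by simp
qed

lemma distortion_P_mix:
  assumes "finite \<alpha>" "\<alpha> \<noteq> {}"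
  obtains f where "range f \<subseteq> \<alpha>" "mono f"
    "\<And>k a. a \<in> \<alpha> \<Longrightarrow> (real k - f k)\<^sup>2 \<le> (real k - a)\<^sup>2"
    "summable (\<lambda>k. weight k * (real k - f k)\<^sup>2)"
    "distortion P_mix \<alpha> = ennreal (\<Sum>k. weight k * (real k - f k)\<^sup>2)"
proof -
  have "\<exists>a\<in>\<alpha>. Min ((\<lambda>a. (real k - a)\<^sup>2) ` \<alpha>) = (real k - a)\<^sup>2" for k
    using Min_in[of "(\<lambda>a. (real k - a)\<^sup>2) ` \<alpha>"] assms
    by (metis (no_types, lifting) finite_imageI image_is_empty imageE)
  then obtain f where f: "\<And>k. f k \<in> \<alpha>"
    and Min_f: "\<And>k. Min ((\<lambda>a. (real k - a)\<^sup>2) ` \<alpha>) = (real k - f k)\<^sup>2"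
    by metis
  have le: "(real k - f k)\<^sup>2 \<le> (real k - a)\<^sup>2" if "a \<in> \<alpha>" for k a
    using Min_le[of "(\<lambda>a. (real k - a)\<^sup>2) ` \<alpha>" "(real k - a)\<^sup>2"] assms that
    by (auto simp: Min_f[symmetric])
  have "mono f"
  proof (rule monoI)
    fix k l :: nat
    assume "k \<le> l"
    then consider "k = l" | "k < l"
      by linarith
    then show "f k \<le> f l"
    proof cases
      case 2
      then show ?thesis
        using nearest_point_mono[of "real k" "f k" "f l" "real l"] le[OF f, of k l] le[OF f, of l k]
        by (simp add: abs_le_square_iff)
    qed simp
  qed
  obtain a where a: "a \<in> \<alpha>"
    using assms by blast
  \<comment> \<open>The cost of sending every atom to the single point \<open>a\<close>
    dominates.\<close>
  have summable: "summable (\<lambda>k. weight k * (real k - f k)\<^sup>2)"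
    by (rule summable_comparison_test'[OF summable_weight_square[of a]])
      (use a le weight_nonneg in \<open>auto simp: abs_mult intro!: mult_mono\<close>)
  have "(\<lambda>x. Min ((\<lambda>a. \<bar>x - a\<bar>\<^sup>2) ` \<alpha>)) \<in> borel_measurable borel"
    using assms by (intro borel_measurable_Min) auto
  then have "distortion P_mix \<alpha> = (\<Sum>k. ennreal (weight k * (real k - f k)\<^sup>2))"
    unfolding distortion_def
    by (subst nn_integral_P_mix) (auto simp: Min_f ennreal_mult weight_nonneg)
  also have "\<dots> = ennreal (\<Sum>k. weight k * (real k - f k)\<^sup>2)"
    using summable by (intro suminf_ennreal2) (auto simp: weight_nonneg)
  finally show thesis
    using f le summable \<open>mono f\<close> by (intro that[of f]) auto
qed

section \<open>Case analysis over the partitions of the atoms\<close>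

text \<open>The strict alternative disposes of all partitions but one; the equality alternative
  records the values that later give uniqueness.\<close>

lemma cost_lower_bound:
  fixes f :: "nat \<Rightarrow> real"
  assumes f: "mono f" "range f \<subseteq> \<alpha>" "finite \<alpha>" "card \<alpha> \<le> 4"
    and summable: "summable (\<lambda>k. weight k * (real k - f k)\<^sup>2)"
  defines "S \<equiv> \<Sum>k. weight k * (real k - f k)\<^sup>2"
  shows "1/6 < S \<or> S = 1/6 \<and> f 1 = 5/3 \<and> f 3 = 3 \<and> f 4 = 13/3 \<and> f 6 = 7"
proof -
  define d where "d k = weight k * (real k - f k)\<^sup>2" for k
  have S: "S = suminf d" and "summable d"
    using summable by (simp_all add: S_def d_def[abs_def])
  have d_nonneg: "0 \<le> d k" for k
    by (simp add: d_def weight_nonneg)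
  have "d 0 = 0"
    by (simp add: d_def weight_def)
  have sum_le: "sum d {..<n} \<le> S" for n
    unfolding S using \<open>summable d\<close> d_nonneg by (intro sum_le_suminf) auto
  have sum8: "d 1 + d 2 + d 3 + d 4 + d 5 + d 6 + d 7 \<le> S"
    using sum_le[of 8] \<open>d 0 = 0\<close> by (simp add: eval_nat_numeral)
  have const: "\<forall>k\<ge>n. f k = f n"
    if "i \<le> j" "j \<le> m" "m \<le> n" "f i \<noteq> f j" "f j \<noteq> f m" "f m \<noteq> f n" for i j m n
    using mono_const_after_three_jumps[OF f that] by blast
  have tail: "S = sum d {..<n} + 2 * (2 + (real n + 1 - f n)\<^sup>2) / 2 ^ n"
    if "\<forall>k\<ge>n. f k = f n" "4 \<le> n" for n
  proof -
    have "d (k + n) = weight (k + n) * (real (k + n) - f n)\<^sup>2" for k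
      using that(1)[rule_format, of "k + n"] by (simp add: d_def)
    then have "(\<lambda>k. d (k + n)) sums (2 * (2 + (real n + 1 - f n)\<^sup>2) / 2 ^ n)"
      using tail_sums[OF that(2), of "f n"] by simp
    then show ?thesis
      unfolding S using suminf_split_initial_segment[OF \<open>summable d\<close>, of n]
      by (simp add: sums_iff)
  qed
  \<comment> \<open>Dropping the square leaves the tail's variance times its mass, 4/2^n. The tail
    from 6 is also kept exactly, since it occurs in the optimal partition.\<close>
  have tail4: "d 1 + d 2 + d 3 + 1/4 \<le> S" if "\<forall>k\<ge>4. f k = f 4"
    using tail[OF that] \<open>d 0 = 0\<close> by (simp add: eval_nat_numeral)
  have tail5: "d 1 + d 2 + d 3 + d 4 + 1/8 \<le> S" if "\<forall>k\<ge>5. f k = f 5"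
    using tail[OF that] \<open>d 0 = 0\<close> by (simp add: eval_nat_numeral)
  have tail6: "S = d 1 + d 2 + d 3 + d 4 + d 5 + 1/16 + (7 - f 6)\<^sup>2 / 32" if "\<forall>k\<ge>6. f k = f 6"
    using tail[OF that] \<open>d 0 = 0\<close> by (simp add: eval_nat_numeral)
  have tail6': "d 1 + d 2 + d 3 + d 4 + d 5 + 1/16 \<le> S" if "\<forall>k\<ge>6. f k = f 6"
    using tail6[OF that] by simp
  have tail7: "d 1 + d 2 + d 3 + d 4 + d 5 + d 6 + 1/32 \<le> S" if "\<forall>k\<ge>7. f k = f 7"
    using tail[OF that] \<open>d 0 = 0\<close> by (simp add: eval_nat_numeral)
  note unfold = d_def weight_numeral power2_eq_square
  have d3: "d 3 = (f 3 - 3)\<^sup>2 / 2"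
    by (simp add: unfold algebra_simps)
  \<comment> \<open>Parallel-axis identities: the coefficient of the square is the mass of the
    block, its centre the conditional mean, and the constant the minimal cost of the block. The
    equality case needs the squares for \<open>{1,2}\<close> and \<open>{4,5}\<close>; elsewhere the
    constants suffice.\<close>
  have block12: "d 1 + d 2 = 1/12 + 3/8 * (f 1 - 5/3)\<^sup>2" if "f 1 = f 2"
    by (simp add: unfold that del: One_nat_def) (simp add: field_simps)
  have block45: "d 4 + d 5 = 1/48 + 3/32 * (f 4 - 13/3)\<^sup>2" if "f 4 = f 5"
    by (simp add: unfold that del: One_nat_def) (simp add: field_simps)
  have "d 2 + d 3 = 1/6 + 3/4 * (f 2 - 8/3)\<^sup>2" if "f 2 = f 3"
    by (simp add: unfold that del: One_nat_def) (simp add: field_simps)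
  then have block23: "1/6 \<le> d 2 + d 3" if "f 2 = f 3"
    using that by simp
  have "d 1 + d 2 + d 3 = 13/28 + 7/8 * (f 3 - 17/7)\<^sup>2" if "f 1 = f 2" "f 2 = f 3"
    by (simp add: unfold that del: One_nat_def) (simp add: field_simps)
  then have block123: "13/28 \<le> d 1 + d 2 + d 3" if "f 1 = f 2" "f 2 = f 3"
    using that by simp
  have "d 3 + d 4 = 1/18 + 9/16 * (f 3 - 28/9)\<^sup>2" if "f 3 = f 4"
    by (simp add: unfold that del: One_nat_def) (simp add: field_simps)
  then have block34: "1/18 \<le> d 3 + d 4" if "f 3 = f 4"
    using that by simp
  have "d 2 + d 3 + d 4 = 7/26 + 13/16 * (f 4 - 36/13)\<^sup>2" if "f 2 = f 3" "f 3 = f 4"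
    by (simp add: unfold that del: One_nat_def) (simp add: field_simps)
  then have block234: "7/26 \<le> d 2 + d 3 + d 4" if "f 2 = f 3" "f 3 = f 4"
    using that by simp
  have "d 3 + d 4 + d 5 = 49/304 + 19/32 * (f 5 - 61/19)\<^sup>2" if "f 3 = f 4" "f 4 = f 5"
    by (simp add: unfold that del: One_nat_def) (simp add: field_simps)
  then have block345: "49/304 \<le> d 3 + d 4 + d 5" if "f 3 = f 4" "f 4 = f 5"
    using that by simp
  have "d 3 + d 4 + d 5 + d 6 = 349/1248 + 39/64 * (f 6 - 128/39)\<^sup>2"
    if "f 3 = f 4" "f 4 = f 5" "f 5 = f 6"
    by (simp add: unfold that del: One_nat_def) (simp add: field_simps)
  then have block3456: "349/1248 \<le> d 3 + d 4 + d 5 + d 6" if "f 3 = f 4" "f 4 = f 5" "f 5 = f 6"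
    using that by simp
  have "d 4 + d 5 + d 6 = 13/224 + 7/64 * (f 6 - 32/7)\<^sup>2" if "f 4 = f 5" "f 5 = f 6"
    by (simp add: unfold that del: One_nat_def) (simp add: field_simps)
  then have block456: "13/224 \<le> d 4 + d 5 + d 6" if "f 4 = f 5" "f 5 = f 6"
    using that by simp
  have "d 4 + d 5 + d 6 + d 7 = 97/960 + 15/128 * (f 7 - 71/15)\<^sup>2"
    if "f 4 = f 5" "f 5 = f 6" "f 6 = f 7"
    by (simp add: unfold that del: One_nat_def) (simp add: field_simps)
  then have block4567: "97/960 \<le> d 4 + d 5 + d 6 + d 7" if "f 4 = f 5" "f 5 = f 6" "f 6 = f 7"
    using that by simp
  have "d 5 + d 6 = 1/96 + 3/64 * (f 5 - 16/3)\<^sup>2" if "f 5 = f 6"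
    by (simp add: unfold that del: One_nat_def) (simp add: field_simps)
  then have block56: "1/96 \<le> d 5 + d 6" if "f 5 = f 6"
    using that by simp
  have "d 5 + d 6 + d 7 = 13/448 + 7/128 * (f 7 - 39/7)\<^sup>2" if "f 5 = f 6" "f 6 = f 7"
    by (simp add: unfold that del: One_nat_def) (simp add: field_simps)
  then have block567: "13/448 \<le> d 5 + d 6 + d 7" if "f 5 = f 6" "f 6 = f 7"
    using that by simp
  note bounds = sum8 d_nonneg[of 1] d_nonneg[of 2] d_nonneg[of 3] d_nonneg[of 4] d_nonneg[of 5]
    d_nonneg[of 6] d_nonneg[of 7]
  have block12': "1/12 \<le> d 1 + d 2" if "f 1 = f 2"
    using block12[OF that] by simp
  have block45': "1/48 \<le> d 4 + d 5" if "f 4 = f 5"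
    using block45[OF that] by simp
  consider (A) "f 1 = f 2" "f 2 = f 3" | (B) "f 1 \<noteq> f 2" "f 2 = f 3" | (C) "f 1 \<noteq> f 2" "f 2 \<noteq> f 3"
    | (D) "f 1 = f 2" "f 2 \<noteq> f 3"
    by blast
  then show ?thesis
  proof cases
    case A
    show ?thesis
      by (rule disjI1) (use block123[OF A] bounds in linarith)
  next
    case B
    \<comment> \<open>The block \<open>{2,3}\<close> alone costs 1/6, so any further positive cost
      gives strictness.\<close>
    consider "f 3 = f 4" | "f 3 \<noteq> f 4" "f 4 = f 5" | "f 3 \<noteq> f 4" "f 4 \<noteq> f 5"
      by blast
    then show ?thesis
    proof cases
      case 1
      show ?thesis
        by (rule disjI1) (use block234[OF B(2) 1] bounds in linarith)
    next
      case 2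
      show ?thesis
        by (rule disjI1) (use block23[OF B(2)] block45'[OF 2(2)] bounds in linarith)
    next
      case 3
      \<comment> \<open>The indices 1, 2, 4 represent the runs \<open>{1}\<close>,
        \<open>{2,3}\<close>, \<open>{4}\<close>; the fourth run starts at 5. The later uses of
        \<open>const\<close> follow the same pattern.\<close>
      have const_tail: "\<forall>k\<ge>5. f k = f 5"
        by (rule const[of 1 2 4]) (use B 3 in auto)
      show ?thesis
        by (rule disjI1) (use tail5[OF const_tail] block23[OF B(2)] bounds in linarith)
    qed
  next
    case C
    \<comment> \<open>Two jumps are spent, so the next one fixes the tail; if it does not come
      before 6, the block \<open>{3,4,5,6}\<close> is already too expensive.\<close>
    consider "f 3 \<noteq> f 4" | "f 3 = f 4" "f 4 \<noteq> f 5" | "f 3 = f 4" "f 4 = f 5" "f 5 = f 6"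
      | "f 3 = f 4" "f 4 = f 5" "f 5 \<noteq> f 6"
      by blast
    then show ?thesis
    proof cases
      case 1
      have const_tail: "\<forall>k\<ge>4. f k = f 4"
        by (rule const[of 1 2 3]) (use C 1 in auto)
      show ?thesis
        by (rule disjI1) (use tail4[OF const_tail] bounds in linarith)
    next
      case 2
      have const_tail: "\<forall>k\<ge>5. f k = f 5"
        by (rule const[of 1 2 3]) (use C 2 in auto)
      show ?thesis
        by (rule disjI1) (use tail5[OF const_tail] block34[OF 2(1)] bounds in linarith)
    next
      case 3
      show ?thesis
        by (rule disjI1) (use block3456[OF 3] bounds in linarith)
    next
      case 4
      have const_tail: "\<forall>k\<ge>6. f k = f 6"
        by (rule const[of 1 2 3]) (use C 4 in auto)
      show ?thesis
        by (rule disjI1) (use tail6'[OF const_tail] block345[OF 4(1,2)] bounds in linarith)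
    qed
  next
    case D
    consider "f 3 = f 4" "f 4 = f 5" | "f 3 = f 4" "f 4 \<noteq> f 5" "f 5 \<noteq> f 6"
      | "f 3 = f 4" "f 4 \<noteq> f 5" "f 5 = f 6" "f 6 \<noteq> f 7"
      | "f 3 = f 4" "f 4 \<noteq> f 5" "f 5 = f 6" "f 6 = f 7"
      | "f 3 \<noteq> f 4" "f 4 \<noteq> f 5"
      | "f 3 \<noteq> f 4" "f 4 = f 5" "f 5 = f 6" "f 6 = f 7"
      | "f 3 \<noteq> f 4" "f 4 = f 5" "f 5 = f 6" "f 6 \<noteq> f 7"
      | "f 3 \<noteq> f 4" "f 4 = f 5" "f 5 \<noteq> f 6"
      by blast
    then show ?thesis
    proof cases
      case 1
      show ?thesis
        by (rule disjI1) (use block345[OF 1] block12'[OF D(1)] bounds in linarith)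
    next
      case 2
      have const_tail: "\<forall>k\<ge>6. f k = f 6"
        by (rule const[of 2 3 5]) (use D 2 in auto)
      show ?thesis
        by (rule disjI1)
          (use tail6'[OF const_tail] block34[OF 2(1)] block12'[OF D(1)] bounds in linarith)
    next
      case 3
      have const_tail: "\<forall>k\<ge>7. f k = f 7"
        by (rule const[of 2 3 5]) (use D 3 in auto)
      show ?thesis
        by (rule disjI1)
          (use tail7[OF const_tail] block34[OF 3(1)] block56[OF 3(3)] block12'[OF D(1)] bounds in linarith)
    next
      case 4
      \<comment> \<open>The tightest case: 1/18 + 13/448 barely exceeds 1/12. Atom 7 is essential,
        as \<open>{5,6}\<close> contributes only 1/96.\<close>
      show ?thesis
        by (rule disjI1)
          (use block34[OF 4(1)] block567[OF 4(3,4)] block12'[OF D(1)] bounds in linarith)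
    next
      case 5
      have const_tail: "\<forall>k\<ge>5. f k = f 5"
        by (rule const[of 2 3 4]) (use D 5 in auto)
      show ?thesis
        by (rule disjI1) (use tail5[OF const_tail] block12'[OF D(1)] bounds in linarith)
    next
      case 6
      show ?thesis
        by (rule disjI1) (use block4567[OF 6(2-4)] block12'[OF D(1)] bounds in linarith)
    next
      case 7
      have const_tail: "\<forall>k\<ge>7. f k = f 7"
        by (rule const[of 2 3 4]) (use D 7 in auto)
      show ?thesis
        by (rule disjI1)
          (use tail7[OF const_tail] block456[OF 7(2,3)] block12'[OF D(1)] bounds in linarith)
    next
      case 8
      have const_tail: "\<forall>k\<ge>6. f k = f 6"
        by (rule const[of 2 3 4]) (use D 8 in auto)
      \<comment> \<open>The optimal partition: 1/12 + 0 + 1/48 + 1/16 = 1/6, plus squares that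
        vanish only at the block means.\<close>
      from tail6[OF const_tail]
      have "S = 1/6 + 3/8 * (f 1 - 5/3)\<^sup>2 + (f 3 - 3)\<^sup>2 / 2 + 3/32 * (f 4 - 13/3)\<^sup>2
          + (7 - f 6)\<^sup>2 / 32"
        using block12[OF D(1)] block45[OF 8(2)] d3 by linarith
      moreover have "0 \<le> (f 1 - 5/3)\<^sup>2" "0 \<le> (f 3 - 3)\<^sup>2" "0 \<le> (f 4 - 13/3)\<^sup>2" "0 \<le> (7 - f 6)\<^sup>2"
        by simp_all
      ultimately have "1/6 < S \<or> S = 1/6 \<and> (f 1 - 5/3)\<^sup>2 = 0 \<and> (f 3 - 3)\<^sup>2 = 0
          \<and> (f 4 - 13/3)\<^sup>2 = 0 \<and> (7 - f 6)\<^sup>2 = 0"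
        by linarith
      then show ?thesis
        by auto
    qed
  qed
qed

section \<open>Optimality and uniqueness of the four points\<close>

text \<open>In the equality case the four forced values are distinct members of \<alpha>, so the
  cardinality bound leaves no other point.\<close>

lemma distortion_lower_bound:
  assumes "finite \<alpha>" "1 \<le> card \<alpha>" "card \<alpha> \<le> 4"
  shows "ennreal (1/6) < distortion P_mix \<alpha> \<or>
    distortion P_mix \<alpha> = ennreal (1/6) \<and> \<alpha> = {5/3, 3, 13/3, 7}"
proof -
  have "\<alpha> \<noteq> {}"
    using assms by auto
  then obtain f where f: "range f \<subseteq> \<alpha>" "mono f"
    "\<And>k a. a \<in> \<alpha> \<Longrightarrow> (real k - f k)\<^sup>2 \<le> (real k - a)\<^sup>2"
    "summable (\<lambda>k. weight k * (real k - f k)\<^sup>2)"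
    and dist: "distortion P_mix \<alpha> = ennreal (\<Sum>k. weight k * (real k - f k)\<^sup>2)"
    by (rule distortion_P_mix[OF assms(1)]) blast
  show ?thesis
    using cost_lower_bound[OF f(2,1) assms(1,3) f(4)]
  proof (elim disjE conjE)
    assume *: "f 1 = 5/3" "f 3 = 3" "f 4 = 13/3" "f 6 = 7"
      "(\<Sum>k. weight k * (real k - f k)\<^sup>2) = 1/6"
    have "f k \<in> \<alpha>" for k
      using f(1) by auto
    from this[of 1] this[of 3] this[of 4] this[of 6] have "{5/3, 3, 13/3, 7} \<subseteq> \<alpha>"
      unfolding * by simp
    then have "{5/3, 3, 13/3, 7} = \<alpha>"
      using assms by (intro card_seteq) auto
    then show ?thesis
      using dist *(5) by simp
  qed (simp add: dist ennreal_less_iff)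
qed

lemma distortion_optimal: "distortion P_mix {5/3, 3, 13/3, 7} = ennreal (1/6)"
proof -
  let ?\<alpha> = "{5/3, 3, 13/3, 7} :: real set"
  obtain f where "range f \<subseteq> ?\<alpha>" "mono f"
    and le: "\<And>k a. a \<in> ?\<alpha> \<Longrightarrow> (real k - f k)\<^sup>2 \<le> (real k - a)\<^sup>2"
    and summable: "summable (\<lambda>k. weight k * (real k - f k)\<^sup>2)"
    and dist: "distortion P_mix ?\<alpha> = ennreal (\<Sum>k. weight k * (real k - f k)\<^sup>2)"
    by (rule distortion_P_mix[of ?\<alpha>]) auto
  \<comment> \<open>\<open>g\<close> is the assignment of the optimal partition. A nearest-point map
    costs no more, so the upper bound does not require identifying \<open>f\<close>.\<close>
  define g :: "nat \<Rightarrow> real"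
    where "g k = (if k \<le> 2 then 5/3 else if k = 3 then 3 else if k \<le> 5 then 13/3 else 7)" for k
  let ?d = "\<lambda>k. weight k * (real k - g k)\<^sup>2"
  have "(\<lambda>k. ?d (k + 6)) sums (1/16)"
    using tail_sums[of 6 7] by (simp add: g_def)
  then have "?d sums (1/16 + sum ?d {..<6})"
    by (subst (asm) sums_iff_shift) simp
  moreover have "sum ?d {..<6} = 5/48"
    by (simp add: eval_nat_numeral g_def weight_def)
  ultimately have "?d sums (1/6)"
    by simp
  moreover have "weight k * (real k - f k)\<^sup>2 \<le> ?d k" for k
    by (intro mult_left_mono le weight_nonneg) (simp add: g_def)
  ultimately have "(\<Sum>k. weight k * (real k - f k)\<^sup>2) \<le> 1/6"
    by (intro sums_le[OF _ summable_sums[OF summable]])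
  then have "distortion P_mix ?\<alpha> \<le> ennreal (1/6)"
    by (simp add: dist ennreal_leI)
  then show ?thesis
    \<comment> \<open>The upper bound excludes the strict alternative.\<close>
    using distortion_lower_bound[of ?\<alpha>] by auto
qed

lemma quantization_error_P_mix: "quantization_error P_mix 4 = ennreal (1/6)"
  unfolding quantization_error_def
proof (rule antisym)
  show "Inf {distortion P_mix \<alpha> |\<alpha>. finite \<alpha> \<and> 1 \<le> card \<alpha> \<and> card \<alpha> \<le> 4} \<le> ennreal (1/6)"
    by (rule Inf_lower, rule CollectI, rule exI[of _ "{5/3, 3, 13/3, 7}"])
      (simp add: distortion_optimal)
  show "ennreal (1/6) \<le> Inf {distortion P_mix \<alpha> |\<alpha>. finite \<alpha> \<and> 1 \<le> card \<alpha> \<and> card \<alpha> \<le> 4}"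
    by (rule Inf_greatest) (use distortion_lower_bound in force)
qed

section \<open>Conditional means of the blocks and the conclusion\<close>

lemma Av_P_mix: "Av P_mix 1 2 = 5/3" "Av P_mix 4 5 = 13/3"
  by (simp_all add: Av_def measure_P_mix_singleton weight_def eval_nat_numeral)

lemma Av_inf_P_mix: "Av_inf P_mix 6 = 7"
proof -
  have weight: "weight (6 + k) = 1 / 2 ^ k / 64" for k
    by (simp add: weight_def power_add)
  \<comment> \<open>Numerator and denominator share the factor 1/64, leaving 14/2 = 7.\<close>
  have "(\<lambda>k. (real k + 6) / 2 ^ k / 64) sums (14 / 64)"
    using sums_divide[OF geometric_linear_sums[of 6], of 64] by simp
  then have num: "(\<lambda>k. weight (6 + k) * real (6 + k)) sums (14 / 64)"
    unfolding weight by (simp add: add.commute)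
  have den: "(\<lambda>k. weight (6 + k)) sums (2 / 64)"
    unfolding weight using sums_divide[OF geometric_sums[of "1/2 :: real"], of 64]
    by (simp add: power_one_over)
  show ?thesis
    unfolding Av_inf_def measure_P_mix_singleton
      sums_unique[OF num, symmetric] sums_unique[OF den, symmetric]
    by simp
qed

theorem proposition4p2p3:
  shows "(\<forall>\<alpha>. optimal_set_of_means P_mix 4 \<alpha> \<longleftrightarrow> \<alpha> = {Av P_mix 1 2, 3, Av P_mix 4 5, Av_inf P_mix 6})
    \<and> quantization_error P_mix 4 = ennreal (1 / 6)"
proof (intro conjI allI)
  fix \<alpha>
  \<comment> \<open>This makes the set admissible; conversely, a minimizer cannot satisfy the strict
    alternative of the lower bound.\<close>
  have "card {5/3, 3, 13/3, 7 :: real} = 4"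
    by simp
  then show "optimal_set_of_means P_mix 4 \<alpha> \<longleftrightarrow>
      \<alpha> = {Av P_mix 1 2, 3, Av P_mix 4 5, Av_inf P_mix 6}"
    unfolding optimal_set_of_means_def quantization_error_P_mix Av_P_mix Av_inf_P_mix
    using distortion_lower_bound[of \<alpha>] distortion_optimal by auto
qed (rule quantization_error_P_mix)

end
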